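(* Let $X$ be a compact metric space, $f:X\to X$ a continuous map, and $S\subset X$ an isolated invariant set for $f$. (i) Let $\mathcal P=\{P_a=(N_a,L_a):a\in\mathcal A\}$ be an index system for $S$, and let $(a_i)_{i\in\mathbb Z}$ be an allowable sequence. If $(P_{a_i})_{i\in\mathbb Z}$ has a nonzero orbital Conley index, then there is an orbit $(x_i)_{i\in\mathbb Z}$ of $f$ contained in $S$ that follows $(\operatorname{cl}(N_{a_i}\setminus L_{a_i}))_{i\in\mathbb Z}$. (ii) If $f$ is expansive, then there is a $\delta>0$ such that for every index system $\mathcal P=\{P_a=(N_a,L_a):a\in\mathcal A\}$ for $S$ with $\operatorname{diam}(\operatorname{cl}(N_a\setminus L_a))<\delta$ for all $a\in\mathcal A$, and every allowable sequence $(a_i)_{i\in\mathbb Z}$ such that $(P_{a_i})_{i\in\mathbb Z}$ has a nonzero orbital Conley index, the orbit in (i) is unique.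
   Context: Throughout, $X$ is a compact metric space and $f:X\to X$ is continuous. $\operatorname{cl}$ and $\operatorname{Int}$ denote closure and interior in $X$. An orbit of $f$ is a bi-infinite sequence $(x_i)_{i\in\mathbb Z}$ in $X$ with $f(x_i)=x_{i+1}$ for all $i\in\mathbb Z$. A set $T$ is invariant if $f(T)=T$. For $I\subset X$, $\operatorname{Inv} I$ is the maximal invariant subset of $I$. A set $S\subset X$ is an isolated invariant set for $f$ if there is a compact set $I$ (an isolating neighborhood for $S$) with $S=\operatorname{Inv} I\subset\operatorname{Int} I$. Let $f\times f:X\times X\to X\times X$ be $(f\times f)(x,y)=(f(x),f(y))$. The map $f$ is expansive if the diagonal $1_X=\{(x,x):x\in X\}$ is an isolated invariant set for $f\times f$. Given a sequence $\mathcal I=(I_i)_{i\in\mathbb Z}$ of compact sets in $X$, an orbit $(x_i)$ follows $\mathcal I$ if $x_i\in I_i$ for all $i\in\mathbb Z$. The sequence $\mathcal I$ is an isolating neighborhood chain if every orbit $(x_i)$ that follows $\mathcal I$ satisfies $x_i\in\operatorname{Int}(I_i)$ for all $i\in\mathbb Z$. For an isolating neighborhood chain $\mathcal I$, $\operatorname{Inv}_0(\mathcal I)$ is the set of $x\in I_0$ for which there is an orbit $(x_i)$ with $x_0=x$ that follows $\mathcal I$. An index system is a finite collection of compact pairs $\mathcal P=\{P_a=(N_a,L_a):a\in\mathcal A\}$ (with $L_a\subset N_a\subset X$ compact) such that: (1) for each $a\in\mathcal A$ there is at least one $b\in\mathcal A$ such that $P_a$ precedes $P_b$, meaning that (a)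 $L_a$ is a neighborhood in $N_a$ of the exit set $N_{ab}^-=\{x\in N_a: f(x)\notin\operatorname{Int} N_b\}$, and (b) $f(L_a)\cap\operatorname{cl}(N_b\setminus L_b)=\emptyset$; (2) for every sequence $(a_i)_{i\in\mathbb Z}$ in $\mathcal A$ such that $P_{a_i}$ precedes $P_{a_{i+1}}$ for all $i$, the sequence $(\operatorname{cl}(N_{a_i}\setminus L_{a_i}))_{i\in\mathbb Z}$ is an isolating neighborhood chain. A finite or infinite sequence $(a_i)$ in $\mathcal A$ is allowable if $P_{a_i}$ precedes $P_{a_{i+1}}$ for all $i$ (for which both indices occur). The invariant set of $\mathcal P$ is $\operatorname{Inv}(\mathcal P)=\bigcup\operatorname{Inv}_0\big((\operatorname{cl}(N_{a_i}\setminus L_{a_i}))_{i\in\mathbb Z}\big)$, the union being over all allowable sequences $(a_i)_{i\in\mathbb Z}$. For an isolated invariant set $S$, $\mathcal P$ is an index system for $S$ if $\operatorname{Inv}(\mathcal P)=S$. For each $a$, ${N_a}_{L_a}$ is the pointed space obtained from $N_a$ by collapsing $L_a$ to a point $[L_a]$, the base point (as usual, if $L_a=\emptyset$ a disjoint base point is added). If $P_a$ precedes $P_b$, then $f$ induces a continuous base-point preserving map $f_{a,b}:{N_a}_{L_a}\to{N_b}_{L_b}$, sending the class of $x\in N_a\setminus L_a$ to the class of $f(x)\in N_b$ and sending $[L_a]$ to $[L_b]$. Write $H_*(P_a)=H_*({N_a}_{L_a},[L_a])$ for the relative homology and $f_{a,b*}:H_*(P_a)\to H_*(P_b)$ for the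 induced map. For an allowable sequence $(a_i)_{i\in\mathbb Z}$, the sequence $(P_{a_i})$ has a nonzero orbital Conley index if every finite composition $f_{a_{n-1},a_n*}\circ\cdots\circ f_{a_{m+1},a_{m+2}*}\circ f_{a_m,a_{m+1}*}$ (with $m<n$) is nonzero. *)

theory Defs
  imports "HOL-Homology.Homology"
begin

definition is_orbit :: "('a \<Rightarrow> 'a) \<Rightarrow> (int \<Rightarrow> 'a) \<Rightarrow> bool" where
  "is_orbit f x \<longleftrightarrow> (\<forall>i. f (x i) = x (i + 1))"

definition invariant :: "('a \<Rightarrow> 'a) \<Rightarrow> 'a set \<Rightarrow> bool" where
  "invariant f T \<longleftrightarrow> f ` T = T"

definition Inv :: "('a \<Rightarrow> 'a) \<Rightarrow> 'a set \<Rightarrow> 'a set" where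
  "Inv f I = \<Union>{T. T \<subseteq> I \<and> invariant f T}"

lemma Inv_subset: "Inv f I \<subseteq> I"
  and invariant_Inv: "invariant f (Inv f I)"
  and Inv_maximal: "T \<subseteq> I \<Longrightarrow> invariant f T \<Longrightarrow> T \<subseteq> Inv f I"
proof -
  show "Inv f I \<subseteq> I" "T \<subseteq> I \<Longrightarrow> invariant f T \<Longrightarrow> T \<subseteq> Inv f I"
    unfolding Inv_def by auto
  show "invariant f (Inv f I)"
    unfolding Inv_def invariant_def image_Union by auto
qed

definition isolated_invariant_set :: "('a::topological_space \<Rightarrow> 'a) \<Rightarrow> 'a set \<Rightarrow> bool" where
  "isolated_invariant_set f S \<longleftrightarrow> (\<exists>I. compact I \<and> S = Inv f I \<and> S \<subseteq> interior I)"

definition expansive :: "('a::topological_space \<Rightarrow> 'a) \<Rightarrow> bool" where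
  "expansive f \<longleftrightarrow> isolated_invariant_set (map_prod f f) {(x, x) |x. True}"

definition follows :: "(int \<Rightarrow> 'a) \<Rightarrow> (int \<Rightarrow> 'a set) \<Rightarrow> bool" where
  "follows x I \<longleftrightarrow> (\<forall>i. x i \<in> I i)"

definition isolating_neighborhood_chain ::
    "('a::topological_space \<Rightarrow> 'a) \<Rightarrow> (int \<Rightarrow> 'a set) \<Rightarrow> bool" where
  "isolating_neighborhood_chain f I \<longleftrightarrow>
     (\<forall>i. compact (I i)) \<and>
     (\<forall>x. is_orbit f x \<longrightarrow> follows x I \<longrightarrow> (\<forall>i. x i \<in> interior (I i)))"

definition Inv0 :: "('a \<Rightarrow> 'a) \<Rightarrow> (int \<Rightarrow> 'a set) \<Rightarrow> 'a set" where
  "Inv0 f I = {y \<in> I 0. \<exists>x. is_orbit f x \<and> x 0 = y \<and> follows x I}"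

definition precedes ::
    "('a::topological_space \<Rightarrow> 'a) \<Rightarrow> 'a set \<times> 'a set \<Rightarrow> 'a set \<times> 'a set \<Rightarrow> bool" where
  "precedes f P Q \<longleftrightarrow>
     (let (N, L) = P; (N', L') = Q in
        {x \<in> N. f x \<notin> interior N'} \<subseteq> (top_of_set N) interior_of L \<and>
        f ` L \<inter> closure (N' - L') = {})"

definition allowable ::
    "('a::topological_space \<Rightarrow> 'a) \<Rightarrow> 'i set \<Rightarrow> ('i \<Rightarrow> 'a set) \<Rightarrow> ('i \<Rightarrow> 'a set) \<Rightarrow> (int \<Rightarrow> 'i) \<Rightarrow> bool"
  where
  "allowable f A N L a \<longleftrightarrow>
     (\<forall>i. a i \<in> A) \<and>
     (\<forall>i. precedes f (N (a i), L (a i)) (N (a (i + 1)), L (a (i + 1))))"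

text \<open>
  The members \<open>(N a, L a)\<close> are indexed by a finite set \<open>A\<close> in an arbitrary type.  Everything below
  is unaffected by renaming indices, so taking indices in \<^typ>\<open>nat\<close> covers all index systems; this is
  how index systems are quantified over inside a formula.
\<close>

definition index_system ::
    "('a::topological_space \<Rightarrow> 'a) \<Rightarrow> 'i set \<Rightarrow> ('i \<Rightarrow> 'a set) \<Rightarrow> ('i \<Rightarrow> 'a set) \<Rightarrow> bool" where
  "index_system f A N L \<longleftrightarrow>
     finite A \<and>
     (\<forall>a\<in>A. compact (N a) \<and> compact (L a) \<and> L a \<subseteq> N a) \<and>
     (\<forall>a\<in>A. \<exists>b\<in>A. precedes f (N a, L a) (N b, L b)) \<and>
     (\<forall>a. allowable f A N L a \<longrightarrow>
        isolating_neighborhood_chain f (\<lambda>i. closure (N (a i) - L (a i))))"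

definition Inv_system ::
    "('a::topological_space \<Rightarrow> 'a) \<Rightarrow> 'i set \<Rightarrow> ('i \<Rightarrow> 'a set) \<Rightarrow> ('i \<Rightarrow> 'a set) \<Rightarrow> 'a set" where
  "Inv_system f A N L =
     (\<Union>a\<in>{a. allowable f A N L a}. Inv0 f (\<lambda>i. closure (N (a i) - L (a i))))"

definition index_system_for ::
    "('a::topological_space \<Rightarrow> 'a) \<Rightarrow> 'i set \<Rightarrow> ('i \<Rightarrow> 'a set) \<Rightarrow> ('i \<Rightarrow> 'a set) \<Rightarrow> 'a set \<Rightarrow> bool"
  where
  "index_system_for f A N L S \<longleftrightarrow> index_system f A N L \<and> Inv_system f A N L = S"

text \<open>
  The points of the pointed space obtained from \<open>N\<close> by collapsing \<open>L\<close> are \<open>Some x\<close> for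
  \<open>x \<in> N - L\<close> together with the base point \<open>None\<close>.  It carries the quotient topology of the
  projection from \<open>N\<close>.  If \<open>L = {}\<close>, then \<open>None\<close> is not hit by the projection and is
  therefore an isolated point, i.e. a disjoint base point.
\<close>

definition collapse :: "'a set \<Rightarrow> 'a \<Rightarrow> 'a option" where
  "collapse L x = (if x \<in> L then None else Some x)"

definition pointed_space :: "'a::topological_space set \<Rightarrow> 'a set \<Rightarrow> 'a option topology" where
  "pointed_space N L = topology (\<lambda>U. U \<subseteq> insert None (Some ` (N - L)) \<and>
     openin (top_of_set N) {x \<in> N. collapse L x \<in> U})"

lemma openin_pointed_space:
  "openin (pointed_space N L) U \<longleftrightarrow>
     U \<subseteq> insert None (Some ` (N - L)) \<and> openin (top_of_set N) {x \<in> N. collapse L x \<in> U}"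
proof -
  have "istopology (\<lambda>U. U \<subseteq> insert None (Some ` (N - L)) \<and>
     openin (top_of_set N) {x \<in> N. collapse L x \<in> U})" (is "istopology ?P")
    unfolding istopology_def
  proof (rule conjI; intro allI impI)
    fix S T assume "?P S" "?P T"
    moreover have "{x \<in> N. collapse L x \<in> S \<inter> T} = {x \<in> N. collapse L x \<in> S} \<inter> {x \<in> N. collapse L x \<in> T}"
      by auto
    ultimately show "?P (S \<inter> T)" by auto
  next
    fix K assume K: "\<forall>U\<in>K. ?P U"
    have "{x \<in> N. collapse L x \<in> \<Union>K} = (\<Union>U\<in>K. {x \<in> N. collapse L x \<in> U})"
      by blast
    moreover have "openin (top_of_set N) (\<Union>U\<in>K. {x \<in> N. collapse L x \<in> U})"
      using K by (intro openin_Union) blast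
    moreover have "\<Union>K \<subseteq> insert None (Some ` (N - L))"
      using K by (intro Union_least) blast
    ultimately show "?P (\<Union>K)" by simp
  qed
  then show ?thesis
    by (simp add: pointed_space_def)
qed

lemma topspace_pointed_space: "topspace (pointed_space N L) = insert None (Some ` (N - L))"
proof -
  have "{x \<in> N. collapse L x \<in> insert None (Some ` (N - L))} = N"
    by (auto simp: collapse_def)
  then have "openin (pointed_space N L) (insert None (Some ` (N - L)))"
    unfolding openin_pointed_space by simp
  then show ?thesis
    by (intro subset_antisym openin_subset)
      (meson openin_pointed_space openin_topspace)+
qed

lemma quotient_map_collapse:
  assumes "L \<subseteq> N" "L \<noteq> {}"
  shows "quotient_map (top_of_set N) (pointed_space N L) (collapse L)"
  using assms
  by (auto simp: quotient_map_def topspace_pointed_space openin_pointed_space collapse_def image_iff)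

definition induced_map :: "('a \<Rightarrow> 'a) \<Rightarrow> 'a set \<Rightarrow> 'a option \<Rightarrow> 'a option" where
  "induced_map f L' = case_option None (\<lambda>x. collapse L' (f x))"

text \<open>
  \<^const>\<open>hom_induced\<close> is trivial on maps that are not continuous, so the following shows that it
  is only used on maps for which it is meaningful.
\<close>

lemma continuous_map_induced_map:
  assumes f: "continuous_on UNIV f" and "closed N'" "L \<subseteq> N" "L' \<subseteq> N'"
    and prec: "precedes f (N, L) (N', L')"
  shows "continuous_map (pointed_space N L) (pointed_space N' L') (induced_map f L')"
proof -
  have ex: "f x \<in> interior N'" if "x \<in> N" "x \<notin> L" for x
    using prec that interior_of_subset[of "top_of_set N" L] unfolding precedes_def by auto
  have disj: "f x \<notin> closure (N' - L')" if "x \<in> L" for x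
    using prec that unfolding precedes_def by auto
  have disj': "f x \<in> L'" if "x \<in> L" "f x \<in> N'" for x
    using disj[OF that(1)] that(2) closure_subset[of "N' - L'"] by auto
  have fo: "open (f -` W)" if "open W" for W
    using f that by (simp add: open_vimage)
  have "openin (pointed_space N L) {y \<in> topspace (pointed_space N L). induced_map f L' y \<in> U}"
    if U: "openin (pointed_space N' L') U" for U
  proof -
    let ?V = "{x \<in> N. collapse L x \<in> topspace (pointed_space N L) \<and> induced_map f L' (collapse L x) \<in> U}"
    obtain W where W: "open W" "{x \<in> N'. collapse L' x \<in> U} = N' \<inter> W"
      using U by (auto simp: openin_pointed_space openin_open)
    have Wiff: "collapse L' z \<in> U \<longleftrightarrow> z \<in> W" if "z \<in> N'" for z
      using W(2) that by blast
    have "openin (top_of_set N) ?V"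
    proof (cases "None \<in> U")
      case True
      define C where "C = closure (N' - L') - W"
      have C: "C \<subseteq> N'"
        using \<open>closed N'\<close> closure_minimal[of "N' - L'" N'] by (auto simp: C_def)
      have "?V = N \<inter> f -` (- C)"
      proof (rule equalityI; rule subsetI)
        fix x assume "x \<in> ?V"
        then show "x \<in> N \<inter> f -` (- C)"
          using disj C Wiff[of "f x"] interior_subset
          by (auto simp: collapse_def induced_map_def C_def split: if_splits)
      next
        fix x assume x: "x \<in> N \<inter> f -` (- C)"
        show "x \<in> ?V"
        proof (cases "x \<in> L")
          case True
          then show ?thesis
            using x \<open>None \<in> U\<close> by (auto simp: topspace_pointed_space collapse_def induced_map_def)
        next
          case False
          then have "f x \<in> N'"
            using ex x interior_subset by blast
          moreover have "f x \<in> W \<or> f x \<in> L'"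
            using x \<open>f x \<in> N'\<close> closure_subset[of "N' - L'"] by (auto simp: C_def)
          ultimately have "collapse L' (f x) \<in> U"
            using Wiff[of "f x"] \<open>None \<in> U\<close> by (cases "f x \<in> L'") (auto simp: collapse_def)
          then show ?thesis
            using False x by (auto simp: topspace_pointed_space collapse_def induced_map_def)
        qed
      qed
      moreover have "open (f -` (- C))"
        unfolding C_def using W(1) by (intro fo open_Compl closed_Diff closed_closure)
      ultimately show ?thesis
        by (auto simp: openin_open)
    next
      case False
      then have WL: "W \<inter> L' = {}"
        using Wiff \<open>L' \<subseteq> N'\<close> False unfolding collapse_def by (metis disjoint_iff subsetD)
      have "?V = N \<inter> f -` (W \<inter> interior N')"
      proof (rule equalityI; rule subsetI)
        fix x assume x: "x \<in> ?V"
        then have "x \<in> N" "x \<notin> L" "collapse L' (f x) \<in> U"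
          using False by (auto simp: collapse_def induced_map_def split: if_splits)
        then show "x \<in> N \<inter> f -` (W \<inter> interior N')"
          using ex[of x] Wiff[of "f x"] interior_subset by auto
      next
        fix x assume x: "x \<in> N \<inter> f -` (W \<inter> interior N')"
        then have "f x \<in> N'"
          using interior_subset by blast
        then have "x \<notin> L"
          using x WL disj' by blast
        then show "x \<in> ?V"
          using x \<open>f x \<in> N'\<close> Wiff
          by (auto simp: topspace_pointed_space collapse_def induced_map_def)
      qed
      moreover have "open (f -` (W \<inter> interior N'))"
        by (intro fo) (auto simp: W)
      ultimately show ?thesis
        by (auto simp: openin_open)
    qed
    then show ?thesis
      by (auto simp: openin_pointed_space topspace_pointed_space)
  qed
  moreover have "induced_map f L' \<in> topspace (pointed_space N L) \<rightarrow> topspace (pointed_space N' L')"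
    using ex interior_subset by (fastforce simp: topspace_pointed_space induced_map_def collapse_def)
  ultimately show ?thesis
    by (simp add: continuous_map image_subset_iff_funcset)
qed

abbreviation index_homology :: "int \<Rightarrow> 'a::topological_space set \<Rightarrow> 'a set \<Rightarrow> ('a option chain) set monoid"
  where "index_homology p N L \<equiv> relative_homology_group p (pointed_space N L) {None}"

definition index_map ::
    "('a::topological_space \<Rightarrow> 'a) \<Rightarrow> int \<Rightarrow> 'a set \<times> 'a set \<Rightarrow> 'a set \<times> 'a set
      \<Rightarrow> ('a option chain) set \<Rightarrow> ('a option chain) set" where
  "index_map f p P Q =
     (let (N, L) = P; (N', L') = Q in
        hom_induced p (pointed_space N L) {None} (pointed_space N' L') {None} (induced_map f L'))"

text \<open>
  \<open>index_map_comp f N L a p m k\<close> is the degree \<open>p\<close> part of the composition of the \<open>k\<close> consecutive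
  maps that start at index \<open>m\<close> and end at index \<open>m + k\<close>.
\<close>

primrec index_map_comp ::
    "('a::topological_space \<Rightarrow> 'a) \<Rightarrow> ('i \<Rightarrow> 'a set) \<Rightarrow> ('i \<Rightarrow> 'a set) \<Rightarrow> (int \<Rightarrow> 'i)
      \<Rightarrow> int \<Rightarrow> int \<Rightarrow> nat \<Rightarrow> ('a option chain) set \<Rightarrow> ('a option chain) set" where
  "index_map_comp f N L a p m 0 = id"
| "index_map_comp f N L a p m (Suc k) =
     index_map f p (N (a (m + int k)), L (a (m + int k))) (N (a (m + int k + 1)), L (a (m + int k + 1)))
       \<circ> index_map_comp f N L a p m k"

text \<open>
  A map of graded groups is nonzero if it is nonzero in some degree; that degree may depend on
  the composition considered.
\<close>

definition nonzero_orbital_index ::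
    "('a::topological_space \<Rightarrow> 'a) \<Rightarrow> ('i \<Rightarrow> 'a set) \<Rightarrow> ('i \<Rightarrow> 'a set) \<Rightarrow> (int \<Rightarrow> 'i) \<Rightarrow> bool" where
  "nonzero_orbital_index f N L a \<longleftrightarrow>
     (\<forall>m n. m < n \<longrightarrow>
        (\<exists>p. \<exists>c \<in> carrier (index_homology p (N (a m)) (L (a m))).
           index_map_comp f N L a p m (nat (n - m)) c
             \<noteq> \<one>\<^bsub>index_homology p (N (a n)) (L (a n))\<^esub>))"

end

theory Submission
  imports Defs
begin

text \<open>
  If no orbit segment of length \<open>n - m\<close> runs through the sets \<open>cl (N - L)\<close>, then the composition of
  the maps of pointed spaces from \<open>m\<close> to \<open>n\<close> is already constant at the base point, hence zero in
  homology.  A nonzero orbital index therefore yields segments of all lengths, and Tychonoff's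
  theorem turns them into a full orbit.  Uniqueness holds because two orbits that stay close form an
  orbit of \<open>f \<times> f\<close> near the diagonal.
\<close>

section \<open>Nonzero index maps and finite orbit segments\<close>

text \<open>Such a \<open>g\<close> factors through the pair \<open>(T, T)\<close>, whose relative
  homology is trivial. With \<open>T = {None}\<close> this says that a map constant at the base
  point is zero in every degree.\<close>

lemma hom_induced_into_subspace:
  assumes g: "continuous_map X Y g" "g \<in> S \<rightarrow> T" "g \<in> topspace X \<rightarrow> T"
    and T: "T \<subseteq> topspace Y"
  shows "hom_induced p X S Y T g c = \<one>\<^bsub>relative_homology_group p Y T\<^esub>"
proof -
  let ?Z = "subtopology Y T"
  have "continuous_map X ?Z g"
    using g by (auto simp: continuous_map_in_subtopology)
  moreover have "continuous_map ?Z Y id"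
    by (simp add: continuous_map_from_subtopology)
  ultimately have eq: "hom_induced p X S Y T g c
      = hom_induced p ?Z T Y T id (hom_induced p X S ?Z T g c)"
    using g(2) by (simp add: hom_induced_compose')
  have "trivial_group (relative_homology_group p ?Z T)"
    using trivial_relative_homology_group_topspace[of p ?Z] T
    by (simp add: Int_absorb1)
  then have "hom_induced p X S ?Z T g c = \<one>\<^bsub>relative_homology_group p ?Z T\<^esub>"
    using hom_induced_carrier unfolding trivial_group_def by fastforce
  then show ?thesis
    unfolding eq using hom_induced_hom[of p ?Z T Y T id]
    by (simp add: hom_one)
qed

text \<open>By functoriality the composition of homology maps comes from a single map
  \<open>g\<close> of pointed spaces, the same for all degrees. The induced maps fix
  \<open>None\<close>, so a point once sent to the base point stays there; a value of
  \<open>g\<close> other than \<open>None\<close> therefore records a genuine orbit segment that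
  avoids every \<open>L\<close>. The restriction of \<open>c\<close> to the carrier matters already
  for \<open>k = 0\<close>, where \<open>hom_induced\<close> of \<open>id\<close> is the identity on
  the carrier.\<close>

lemma index_map_comp_eq_hom_induced:
  assumes f: "continuous_on UNIV f"
    and closed: "\<And>i. closed (N (a i))" and sub: "\<And>i. L (a i) \<subseteq> N (a i)"
    and prec: "\<And>i. precedes f (N (a i), L (a i)) (N (a (i + 1)), L (a (i + 1)))"
  obtains g where
    "continuous_map (pointed_space (N (a m)) (L (a m)))
       (pointed_space (N (a (m + int k))) (L (a (m + int k)))) g"
    "g None = None"
    "\<And>y. y \<in> topspace (pointed_space (N (a m)) (L (a m))) \<Longrightarrow> g y \<noteq> None \<Longrightarrow>
       \<exists>x. g y = Some ((f ^^ k) x) \<and>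
         (\<forall>j\<le>k. (f ^^ j) x \<in> N (a (m + int j)) - L (a (m + int j)))"
    "\<And>p c. c \<in> carrier (index_homology p (N (a m)) (L (a m))) \<Longrightarrow>
       index_map_comp f N L a p m k c =
         hom_induced p (pointed_space (N (a m)) (L (a m))) {None}
           (pointed_space (N (a (m + int k))) (L (a (m + int k)))) {None} g c"
proof (induction k arbitrary: thesis)
  case 0
  show ?case
  proof (rule 0[of id])
    fix y assume "y \<in> topspace (pointed_space (N (a m)) (L (a m)))" "id y \<noteq> None"
    then show "\<exists>x. id y = Some ((f ^^ 0) x) \<and>
        (\<forall>j\<le>0. (f ^^ j) x \<in> N (a (m + int j)) - L (a (m + int j)))"
      by (auto simp: topspace_pointed_space)
  qed (simp_all add: hom_induced_id[unfolded id_def] id_def)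
next
  case (Suc k)
  let ?P = "\<lambda>i. pointed_space (N (a i)) (L (a i))"
  obtain g where g: "continuous_map (?P m) (?P (m + int k)) g" "g None = None"
    and orb: "\<And>y. y \<in> topspace (?P m) \<Longrightarrow> g y \<noteq> None \<Longrightarrow>
       \<exists>x. g y = Some ((f ^^ k) x) \<and>
         (\<forall>j\<le>k. (f ^^ j) x \<in> N (a (m + int j)) - L (a (m + int j)))"
    and comp: "\<And>p c. c \<in> carrier (index_homology p (N (a m)) (L (a m))) \<Longrightarrow>
       index_map_comp f N L a p m k c = hom_induced p (?P m) {None} (?P (m + int k)) {None} g c"
    using Suc.IH by blast
  have ix: "m + int (Suc k) = m + int k + 1"
    by simp
  let ?h = "induced_map f (L (a (m + int (Suc k))))"
  have h: "continuous_map (?P (m + int k)) (?P (m + int (Suc k))) ?h"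
    unfolding ix using f closed sub sub prec by (rule continuous_map_induced_map)
  show ?case
  proof (rule Suc.prems)
    show "continuous_map (?P m) (?P (m + int (Suc k))) (?h \<circ> g)"
      using g(1) h by (rule continuous_map_compose)
    show "(?h \<circ> g) None = None"
      by (simp add: g induced_map_def)
  next
    fix y assume y: "y \<in> topspace (?P m)" and ne: "(?h \<circ> g) y \<noteq> None"
    then have "g y \<noteq> None"
      by (cases "g y") (auto simp: induced_map_def)
    then obtain x where x: "g y = Some ((f ^^ k) x)"
      "\<forall>j\<le>k. (f ^^ j) x \<in> N (a (m + int j)) - L (a (m + int j))"
      using orb[OF y] by blast
    have hx: "(?h \<circ> g) y = Some ((f ^^ Suc k) x)"
      using ne x(1) by (auto simp: induced_map_def collapse_def split: if_splits)
    \<comment> \<open>The points of the pointed space other than \<open>None\<close> come exactly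
      from \<open>N - L\<close>, so landing in it extends the segment by one index.\<close>
    moreover have "(?h \<circ> g) y \<in> topspace (?P (m + int (Suc k)))"
      using continuous_map_compose[OF g(1) h] y
      by (meson continuous_map_image_subset_topspace image_subset_iff)
    ultimately have "(f ^^ Suc k) x \<in> N (a (m + int (Suc k))) - L (a (m + int (Suc k)))"
      by (auto simp: topspace_pointed_space)
    with hx x(2) show "\<exists>x. (?h \<circ> g) y = Some ((f ^^ Suc k) x) \<and>
         (\<forall>j\<le>Suc k. (f ^^ j) x \<in> N (a (m + int j)) - L (a (m + int j)))"
      by (metis le_Suc_eq)
  next
    fix p c assume c: "c \<in> carrier (index_homology p (N (a m)) (L (a m)))"
    have "index_map_comp f N L a p m (Suc k) c =
        hom_induced p (?P (m + int k)) {None} (?P (m + int (Suc k))) {None} ?h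
          (hom_induced p (?P m) {None} (?P (m + int k)) {None} g c)"
      by (simp only: index_map_comp.simps o_apply comp[OF c] index_map_def Let_def split ix)
    also have "\<dots> = hom_induced p (?P m) {None} (?P (m + int (Suc k))) {None} (?h \<circ> g) c"
      using g h by (intro hom_induced_compose') (auto simp: induced_map_def)
    finally show "index_map_comp f N L a p m (Suc k) c =
        hom_induced p (?P m) {None} (?P (m + int (Suc k))) {None} (?h \<circ> g) c" .
  qed
qed

text \<open>If \<open>g\<close> were constant at the base point, the composition would vanish in
  every degree, against \<open>nz\<close>. The case \<open>k = 0\<close> is left out because
  \<open>nonzero_orbital_index\<close> speaks only of compositions with
  \<open>m < n\<close>.\<close>

lemma nonzero_orbital_index_imp_segment:
  assumes f: "continuous_on UNIV f"
    and closed: "\<And>i. closed (N (a i))" and sub: "\<And>i. L (a i) \<subseteq> N (a i)"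
    and prec: "\<And>i. precedes f (N (a i), L (a i)) (N (a (i + 1)), L (a (i + 1)))"
    and nz: "nonzero_orbital_index f N L a" and "0 < k"
  shows "\<exists>x. \<forall>j\<le>k. (f ^^ j) x \<in> N (a (m + int j)) - L (a (m + int j))"
proof -
  let ?P = "\<lambda>i. pointed_space (N (a i)) (L (a i))"
  obtain g where g: "continuous_map (?P m) (?P (m + int k)) g" "g None = None"
    and orb: "\<And>y. y \<in> topspace (?P m) \<Longrightarrow> g y \<noteq> None \<Longrightarrow>
       \<exists>x. g y = Some ((f ^^ k) x) \<and>
         (\<forall>j\<le>k. (f ^^ j) x \<in> N (a (m + int j)) - L (a (m + int j)))"
    and comp: "\<And>p c. c \<in> carrier (index_homology p (N (a m)) (L (a m))) \<Longrightarrow>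
       index_map_comp f N L a p m k c = hom_induced p (?P m) {None} (?P (m + int k)) {None} g c"
    using index_map_comp_eq_hom_induced[where a = a and m = m and k = k, OF f closed sub prec]
    by blast
  obtain p c where c: "c \<in> carrier (index_homology p (N (a m)) (L (a m)))"
    and "index_map_comp f N L a p m (nat (m + int k - m)) c
       \<noteq> \<one>\<^bsub>index_homology p (N (a (m + int k))) (L (a (m + int k)))\<^esub>"
    using nz \<open>0 < k\<close> unfolding nonzero_orbital_index_def
    by (metis less_add_same_cancel1 of_nat_0_less_iff)
  then have "hom_induced p (?P m) {None} (?P (m + int k)) {None} g c
      \<noteq> \<one>\<^bsub>index_homology p (N (a (m + int k))) (L (a (m + int k)))\<^esub>"
    using comp[OF c] by simp
  then have "g \<notin> topspace (?P m) \<rightarrow> {None}"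
    using hom_induced_into_subspace[OF g(1), of "{None}" "{None}" p c] g(2)
    by (auto simp: topspace_pointed_space)
  then show ?thesis
    using orb by blast
qed

section \<open>Full orbits from finite segments by compactness\<close>

text \<open>Tychonoff's theorem, carried over from \<open>product_topology\<close> to the topology
  of the function type.\<close>

lemma compact_UNIV_fun:
  assumes "compact (UNIV :: 'a::topological_space set)"
  shows "compact (UNIV :: ('b \<Rightarrow> 'a) set)"
proof -
  have "compactin (product_topology (\<lambda>_. euclidean) UNIV) (PiE UNIV (\<lambda>_::'b. UNIV :: 'a set))"
    using assms by (simp only: compactin_PiE) simp
  then show ?thesis
    by (simp add: euclidean_product_topology PiE_UNIV_domain)
qed

text \<open>\<open>C n\<close> imposes the conditions of an orbit following \<open>M\<close> only on
  the window from \<open>-n\<close> to \<open>n\<close>. These sets are closed, decreasing and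
  nonempty in a compact product space, and any common point is the desired orbit.\<close>

lemma orbit_follows_if_segments:
  fixes f :: "'a::metric_space \<Rightarrow> 'a"
  assumes "compact (UNIV :: 'a set)" and f: "continuous_on UNIV f"
    and M: "\<And>i. closed (M i)"
    and seg: "\<And>m k. 0 < k \<Longrightarrow> \<exists>x. \<forall>j\<le>k. (f ^^ j) x \<in> M (m + int j)"
  shows "\<exists>x. is_orbit f x \<and> follows x M"
proof -
  define C where "C n = {y. \<forall>i\<in>{- int n..int n}. y i \<in> M i \<and> f (y i) = y (i + 1)}" for n
  have cont: "continuous_on UNIV (\<lambda>y :: int \<Rightarrow> 'a. f (y i))" for i
    using continuous_on_compose2[OF f continuous_on_product_coordinates] by simp
  have "closed ((\<lambda>y. y i) -` M i)" for i
    using M continuous_on_product_coordinates by (rule closed_vimage)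
  moreover have "closed {y :: int \<Rightarrow> 'a. f (y i) = y (i + 1)}" for i
    by (intro closed_Collect_eq cont continuous_on_product_coordinates)
  moreover have "C n = (\<Inter>i\<in>{- int n..int n}. (\<lambda>y. y i) -` M i \<inter> {y. f (y i) = y (i + 1)})" for n
    by (auto simp: C_def)
  ultimately have closed: "closed (C n)" for n
    by (simp add: closed_INT closed_Int)
  have ne: "C n \<noteq> {}" for n
  proof -
    \<comment> \<open>The window takes \<open>2 * n\<close> steps; the extra one keeps the length
      positive for \<open>n = 0\<close>, as \<open>seg\<close> demands.\<close>
    obtain x where x: "\<forall>j\<le>2 * n + 1. (f ^^ j) x \<in> M (- int n + int j)"
      using seg[of "2 * n + 1" "- int n"] by auto
    \<comment> \<open>To the left of the window \<open>nat\<close> truncates to 0 and the sequence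
      is constantly \<open>x\<close>, which \<open>C n\<close> does not test.\<close>
    have "(\<lambda>i. (f ^^ nat (i + int n)) x) \<in> C n"
      unfolding C_def
    proof (intro CollectI ballI conjI)
      fix i assume i: "i \<in> {- int n..int n}"
      then show "(f ^^ nat (i + int n)) x \<in> M i"
        using x[rule_format, of "nat (i + int n)"] by auto
      have "nat (i + 1 + int n) = Suc (nat (i + int n))"
        using i by auto
      then show "f ((f ^^ nat (i + int n)) x) = (f ^^ nat (i + 1 + int n)) x"
        by simp
    qed
    then show ?thesis
      by blast
  qed
  have "UNIV \<inter> (\<Inter>n\<in>UNIV. C n) \<noteq> {}"
  proof (rule compact_imp_fip_image)
    fix F :: "nat set" assume "finite F"
    then obtain n where "\<forall>k\<in>F. k \<le> n"
      using finite_nat_set_iff_bounded_le by blast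
    \<comment> \<open>A larger window imposes more conditions, so a bound \<open>n\<close> of
      \<open>F\<close> suffices.\<close>
    then have "C n \<subseteq> (\<Inter>k\<in>F. C k)"
      by (fastforce simp: C_def)
    then show "UNIV \<inter> (\<Inter>k\<in>F. C k) \<noteq> {}"
      using ne[of n] by blast
  qed (use closed compact_UNIV_fun[OF assms(1)] in auto)
  then obtain y where y: "\<And>n. y \<in> C n"
    by blast
  have "y i \<in> M i \<and> f (y i) = y (i + 1)" for i
    using y[of "nat \<bar>i\<bar>"] unfolding C_def by (auto elim!: ballE[of _ _ i])
  then show ?thesis
    by (auto simp: is_orbit_def follows_def)
qed

text \<open>\<open>Inv0\<close> sees only the point at time 0. To reach \<open>x j\<close>, the
  orbit and the index sequence are both shifted by \<open>j\<close>, which preserves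
  allowability.\<close>

lemma orbit_follows_subset_Inv_system:
  assumes "allowable f A N L a" "is_orbit f x"
    and "follows x (\<lambda>i. closure (N (a i) - L (a i)))"
  shows "range x \<subseteq> Inv_system f A N L"
proof clarify
  fix j
  have "allowable f A N L (\<lambda>i. a (i + j))"
    using assms(1) unfolding allowable_def by (metis add.commute add.left_commute)
  moreover have "x j \<in> Inv0 f (\<lambda>i. closure (N (a (i + j)) - L (a (i + j))))"
    unfolding Inv0_def
  proof (intro CollectI conjI exI[of _ "\<lambda>i. x (i + j)"])
    show "is_orbit f (\<lambda>i. x (i + j))"
      using assms(2) unfolding is_orbit_def by (metis add.commute add.left_commute)
  qed (use assms(3) in \<open>auto simp: follows_def\<close>)
  ultimately show "x j \<in> Inv_system f A N L"
    unfolding Inv_system_def by blast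
qed

section \<open>Expansiveness and uniqueness of orbits\<close>

text \<open>Two orbits that stay \<open>\<delta>\<close>-close trace out an invariant set of
  \<open>map_prod f f\<close> inside the isolating neighborhood \<open>I\<close> of the diagonal. By
  maximality of \<open>Inv\<close> this set lies in the diagonal.\<close>

lemma expansive_orbits_eq:
  fixes f :: "'a::metric_space \<Rightarrow> 'a"
  assumes "compact (UNIV :: 'a set)" "expansive f"
  obtains \<delta> where "0 < \<delta>"
    "\<And>x y. is_orbit f x \<Longrightarrow> is_orbit f y \<Longrightarrow> (\<And>i. dist (x i) (y i) < \<delta>) \<Longrightarrow> x = y"
proof -
  let ?D = "{(x, x) |x :: 'a. True}"
  obtain I where I: "?D = Inv (map_prod f f) I" "?D \<subseteq> interior I"
    using assms(2) unfolding expansive_def isolated_invariant_set_def by blast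
  have "continuous_on UNIV (\<lambda>x :: 'a. (x, x))"
    by (intro continuous_intros)
  then have "compact (range (\<lambda>x :: 'a. (x, x)))"
    using assms(1) by (rule compact_continuous_image)
  then have "compact ?D"
    by (simp add: full_SetCompr_eq)
  \<comment> \<open>Compactness of the diagonal yields one radius that works at all of its
    points.\<close>
  then obtain \<delta> where \<delta>: "0 < \<delta>" "(\<Union>d\<in>?D. ball d \<delta>) \<subseteq> interior I"
    using compact_subset_open_imp_ball_epsilon_subset[OF _ open_interior I(2)] by blast
  have near: "(u, v) \<in> I" if "dist u v < \<delta>" for u v
  proof -
    have "(u, v) \<in> ball (u, u) \<delta>"
      using that by (simp add: dist_Pair_Pair)
    then show ?thesis
      using \<delta>(2) interior_subset[of I] by blast
  qed
  show thesis
  proof (rule that[OF \<delta>(1)])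
    fix x y assume orb: "is_orbit f x" "is_orbit f y" and d: "\<And>i. dist (x i) (y i) < \<delta>"
    let ?T = "range (\<lambda>i. (x i, y i))"
    have "map_prod f f ` ?T = range ((\<lambda>i. (x i, y i)) \<circ> (\<lambda>i. i + 1))"
      using orb by (simp add: is_orbit_def image_image)
    \<comment> \<open>The shift is onto the integers, so bi-infinite orbits give equality and not
      just forward invariance.\<close>
    also have "\<dots> = ?T"
      unfolding image_comp[symmetric] by simp
    finally have "invariant (map_prod f f) ?T"
      by (simp add: invariant_def)
    then have "?T \<subseteq> ?D"
      unfolding I(1) using near d by (intro Inv_maximal) auto
    then have "(x i, y i) \<in> ?D" for i
      by (rule subsetD) (rule rangeI)
    then show "x = y"
      by (simp add: fun_eq_iff)
  qed
qed

section \<open>Existence of the orbit in the isolated set, and its uniqueness for expansive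
  maps\<close>

theorem theorem7:
  fixes f :: "'a::metric_space \<Rightarrow> 'a" and S :: "'a set"
  assumes "compact (UNIV :: 'a set)"
    and "continuous_on UNIV f"
    and "isolated_invariant_set f S"
  shows
    "(\<forall>(A :: 'i set) N L a.
        index_system_for f A N L S \<longrightarrow> allowable f A N L a \<longrightarrow> nonzero_orbital_index f N L a \<longrightarrow>
        (\<exists>x. is_orbit f x \<and> range x \<subseteq> S \<and> follows x (\<lambda>i. closure (N (a i) - L (a i)))))
     \<and>
     (expansive f \<longrightarrow>
        (\<exists>\<delta>>0. \<forall>(A :: nat set) N L a.
          index_system_for f A N L S \<longrightarrow>
          (\<forall>b\<in>A. diameter (closure (N b - L b)) < \<delta>) \<longrightarrow>
          allowable f A N L a \<longrightarrow> nonzero_orbital_index f N L a \<longrightarrow>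
          (\<exists>!x. is_orbit f x \<and> range x \<subseteq> S \<and> follows x (\<lambda>i. closure (N (a i) - L (a i))))))"
proof -
  \<comment> \<open>The index type \<open>'j\<close> is left general here, so that the fact serves
    both \<open>'i\<close> in the first claim and \<open>nat\<close> in the second.\<close>
  have ex: "\<exists>x. is_orbit f x \<and> range x \<subseteq> S \<and> follows x (\<lambda>i. closure (N (a i) - L (a i)))"
    if sys: "index_system_for f A N L S" and a: "allowable f A N L a"
      and nz: "nonzero_orbital_index f N L a"
    for A :: "'j set" and N L a
  proof -
    have "a i \<in> A" for i
      using a by (simp add: allowable_def)
    then have "closed (N (a i))" "L (a i) \<subseteq> N (a i)" for i
      using sys by (auto simp: index_system_for_def index_system_def compact_imp_closed)
    moreover have "precedes f (N (a i), L (a i)) (N (a (i + 1)), L (a (i + 1)))" for i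
      using a by (simp add: allowable_def)
    ultimately have seg: "\<exists>x. \<forall>j\<le>k. (f ^^ j) x \<in> N (a (m + int j)) - L (a (m + int j))"
      if "0 < k" for m k
      using assms(2) nz that by (intro nonzero_orbital_index_imp_segment)
    \<comment> \<open>Segments lie in \<open>N - L\<close> itself, but the compactness argument
      needs closed sets.\<close>
    have "\<exists>x. \<forall>j\<le>k. (f ^^ j) x \<in> closure (N (a (m + int j)) - L (a (m + int j)))"
      if "0 < k" for m k
      using seg[OF that, of m] by (meson closure_subset subsetD)
    then obtain x where "is_orbit f x" "follows x (\<lambda>i. closure (N (a i) - L (a i)))"
      using orbit_follows_if_segments[OF assms(1,2), of "\<lambda>i. closure (N (a i) - L (a i))"]
      by auto
    then show ?thesis
      using orbit_follows_subset_Inv_system[OF a] sys by (auto simp: index_system_for_def)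
  qed
  have uniq: "\<exists>\<delta>>0. \<forall>(A :: nat set) N L a.
          index_system_for f A N L S \<longrightarrow>
          (\<forall>b\<in>A. diameter (closure (N b - L b)) < \<delta>) \<longrightarrow>
          allowable f A N L a \<longrightarrow> nonzero_orbital_index f N L a \<longrightarrow>
          (\<exists>!x. is_orbit f x \<and> range x \<subseteq> S \<and> follows x (\<lambda>i. closure (N (a i) - L (a i))))"
    if exp: "expansive f"
  proof -
    obtain \<delta> where "0 < \<delta>" and eq:
      "\<And>x y. is_orbit f x \<Longrightarrow> is_orbit f y \<Longrightarrow> (\<And>i. dist (x i) (y i) < \<delta>) \<Longrightarrow> x = y"
      using expansive_orbits_eq[OF assms(1) exp] by blast
    \<comment> \<open>At each time both orbits lie in the same closure, whose diameter is below
      \<open>\<delta>\<close>; hence the expansivity constant itself can serve as the diameter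
      bound.\<close>
    have close: "dist (x i) (y i) < \<delta>"
      if "\<forall>b\<in>A. diameter (closure (N b - L b)) < \<delta>" "allowable f A N L a"
        "follows x (\<lambda>i. closure (N (a i) - L (a i)))"
        "follows y (\<lambda>i. closure (N (a i) - L (a i)))"
      for A :: "nat set" and N L a x y i
    proof -
      have "bounded (closure (N (a i) - L (a i)))"
        using assms(1) compact_imp_bounded bounded_subset by blast
      then have "dist (x i) (y i) \<le> diameter (closure (N (a i) - L (a i)))"
        using that(3,4) by (intro diameter_bounded_bound) (auto simp: follows_def)
      also have "\<dots> < \<delta>"
        using that(1,2) by (simp add: allowable_def)
      finally show ?thesis .
    qed
    show ?thesis
    proof (intro exI[of _ \<delta>] conjI allI impI \<open>0 < \<delta>\<close>)
      fix A :: "nat set" and N L a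
      assume sys: "index_system_for f A N L S"
        and diam: "\<forall>b\<in>A. diameter (closure (N b - L b)) < \<delta>"
        and a: "allowable f A N L a" and nz: "nonzero_orbital_index f N L a"
      show "\<exists>!x. is_orbit f x \<and> range x \<subseteq> S \<and> follows x (\<lambda>i. closure (N (a i) - L (a i)))"
      proof (rule ex_ex1I)
        show "\<exists>x. is_orbit f x \<and> range x \<subseteq> S \<and> follows x (\<lambda>i. closure (N (a i) - L (a i)))"
          using sys a nz by (rule ex)
      qed (use eq close[OF diam a] in blast)
    qed
  qed
  show ?thesis
  proof (intro conjI allI impI)
    fix A :: "'i set" and N L a
    assume "index_system_for f A N L S" "allowable f A N L a" "nonzero_orbital_index f N L a"
    then show "\<exists>x. is_orbit f x \<and> range x \<subseteq> S \<and> follows x (\<lambda>i. closure (N (a i) - L (a i)))"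
      by (rule ex)
  qed (rule uniq)
qed

end
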